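(* Let $G$ be a group acting on a discrete median algebra $M$ and let $H\subset M$ be a proper half space. The following are equivalent. (i) $H$ is essential, i.e., $GH$ is infinite and $H$ cuts $M$ properly. (ii) For some $x\in M$ both sets $\{gH \mid g\in G,\ x\in gH\}$ and $\{gH\mid g\in G,\ x\notin gH\}$ are infinite. (iii) For some $x\in M$ the set $\{d_H(x,gx)\mid g\in G\}\subseteq\mathbb{N}\cup\{0\}$ is unbounded. (iv) The action of $G$ on $M_H$ is non elliptic.
   Context: A median algebra is a nonempty set $M$ with a map $m: M^3\to M$ such that: $m(x,y,z)=m(x,z,y)=m(y,z,x)$; $m(x,x,y)=x$; $m(m(x,y,z),u,v)=m(x,m(y,u,v),m(z,u,v))$. Interval: $[x,y]=\{z: z=m(x,y,z)\}$. $C\subseteq M$ is convex if $[x,y]\subseteq C$ for all $x,y\in C$. A half space is a subset $H\subseteq M$ such that $H$ and $H^*:=M\setminus H$ are both convex; proper means $H\neq\varnothing,M$. $\Delta(x,y)$ is the set of half spaces containing $x$ but not $y$; $M$ is discrete if all $\Delta(x,y)$ are finite, and then $d(x,y)=|\Delta(x,y)|$ is a metric. Groups act by median automorphisms. The hyper plane of $H$ is $\overline{H}=\{H,H^*\}$, and $\overline{\Delta}(x,y)=\{\overline{J}: J\in\Delta(x,y)\}$. A subset of $M$ is bounded if it has finite diameter. An action on a discrete median algebra is elliptic if some (equivalently every) orbit is bounded. $GH=\{gH: g\in G\}$. $H$ cuts $M$ properly if for some (equivalently every) $x\in M$ both $H\cap Gx$ and $H^*\cap Gx$ are unbounded. $d_H(x,y):=|\overline{\Delta}(x,y)\cap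 G\overline{H}|$, the number of hyper planes in the $G$-orbit of $\overline{H}$ separating $x$ and $y$. $M_H$ is the quotient of $M$ by the $G$-invariant congruence relation $x\sim y \Leftrightarrow d_H(x,y)=0$ (no translate $gH$ or $gH^*$ separates $x$ from $y$); it is a discrete median algebra with induced $G$-action, whose half spaces correspond to $\varnothing$, $M$ and the $gH, gH^*$ ($g\in G$), and whose median metric is induced by $d_H$.
   Formalization: "H cuts M properly" is taken to mean that H∩Gx and H*∩Gx are unbounded for every x in M; the stated equivalence with "for some x" is false in general, and with "for some x" the implication (i)⇒(ii) fails. *)

theory Defs
  imports "HOL-Algebra.Group_Action"
begin

section \<open>Median algebras\<close>

locale median_algebra =
  fixes M :: "'a set" and m :: "'a \<Rightarrow> 'a \<Rightarrow> 'a \<Rightarrow> 'a"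
  assumes nonempty: "M \<noteq> {}"
    and closed: "\<lbrakk>x \<in> M; y \<in> M; z \<in> M\<rbrakk> \<Longrightarrow> m x y z \<in> M"
    and swap: "\<lbrakk>x \<in> M; y \<in> M; z \<in> M\<rbrakk> \<Longrightarrow> m x y z = m x z y"
    and rotate: "\<lbrakk>x \<in> M; y \<in> M; z \<in> M\<rbrakk> \<Longrightarrow> m x y z = m y z x"
    and majority: "\<lbrakk>x \<in> M; y \<in> M\<rbrakk> \<Longrightarrow> m x x y = x"
    and distrib: "\<lbrakk>x \<in> M; y \<in> M; z \<in> M; u \<in> M; v \<in> M\<rbrakk>
      \<Longrightarrow> m (m x y z) u v = m x (m y u v) (m z u v)"

definition interval :: "'a set \<Rightarrow> ('a \<Rightarrow> 'a \<Rightarrow> 'a \<Rightarrow> 'a) \<Rightarrow> 'a \<Rightarrow> 'a \<Rightarrow> 'a set" where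
  "interval M m x y = {z \<in> M. z = m x y z}"

definition median_convex :: "'a set \<Rightarrow> ('a \<Rightarrow> 'a \<Rightarrow> 'a \<Rightarrow> 'a) \<Rightarrow> 'a set \<Rightarrow> bool" where
  "median_convex M m C \<longleftrightarrow> C \<subseteq> M \<and> (\<forall>x\<in>C. \<forall>y\<in>C. interval M m x y \<subseteq> C)"

definition halfspace :: "'a set \<Rightarrow> ('a \<Rightarrow> 'a \<Rightarrow> 'a \<Rightarrow> 'a) \<Rightarrow> 'a set \<Rightarrow> bool" where
  "halfspace M m H \<longleftrightarrow> H \<subseteq> M \<and> median_convex M m H \<and> median_convex M m (M - H)"

definition proper_halfspace :: "'a set \<Rightarrow> ('a \<Rightarrow> 'a \<Rightarrow> 'a \<Rightarrow> 'a) \<Rightarrow> 'a set \<Rightarrow> bool" where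
  "proper_halfspace M m H \<longleftrightarrow> halfspace M m H \<and> H \<noteq> {} \<and> H \<noteq> M"

definition separators :: "'a set \<Rightarrow> ('a \<Rightarrow> 'a \<Rightarrow> 'a \<Rightarrow> 'a) \<Rightarrow> 'a \<Rightarrow> 'a \<Rightarrow> 'a set set" where
  "separators M m x y = {J. halfspace M m J \<and> x \<in> J \<and> y \<notin> J}"

definition median_dist :: "'a set \<Rightarrow> ('a \<Rightarrow> 'a \<Rightarrow> 'a \<Rightarrow> 'a) \<Rightarrow> 'a \<Rightarrow> 'a \<Rightarrow> nat" where
  "median_dist M m x y = card (separators M m x y)"

text \<open>Finite diameter with respect to the median metric.\<close>

definition median_bounded :: "'a set \<Rightarrow> ('a \<Rightarrow> 'a \<Rightarrow> 'a \<Rightarrow> 'a) \<Rightarrow> 'a set \<Rightarrow> bool" where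
  "median_bounded M m S \<longleftrightarrow> bdd_above {median_dist M m x y | x y. x \<in> S \<and> y \<in> S}"

locale discrete_median_algebra = median_algebra +
  assumes discrete: "\<lbrakk>x \<in> M; y \<in> M\<rbrakk> \<Longrightarrow> finite (separators M m x y)"

definition hyperplane :: "'a set \<Rightarrow> 'a set \<Rightarrow> 'a set set" where
  "hyperplane M H = {H, M - H}"

definition separating_hyperplanes ::
    "'a set \<Rightarrow> ('a \<Rightarrow> 'a \<Rightarrow> 'a \<Rightarrow> 'a) \<Rightarrow> 'a \<Rightarrow> 'a \<Rightarrow> 'a set set set" where
  "separating_hyperplanes M m x y = hyperplane M ` separators M m x y"

section \<open>Actions by median automorphisms\<close>

locale discrete_median_action =
  group_action G M \<phi> + discrete_median_algebra M m
  for G (structure) and M \<phi> m +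
  assumes equivariant: "\<lbrakk>g \<in> carrier G; x \<in> M; y \<in> M; z \<in> M\<rbrakk>
    \<Longrightarrow> \<phi> g (m x y z) = m (\<phi> g x) (\<phi> g y) (\<phi> g z)"

definition elliptic ::
    "('g, 'c) monoid_scheme \<Rightarrow> 'a set \<Rightarrow> ('g \<Rightarrow> 'a \<Rightarrow> 'a) \<Rightarrow> ('a \<Rightarrow> 'a \<Rightarrow> 'a \<Rightarrow> 'a) \<Rightarrow> bool" where
  "elliptic G M \<phi> m \<longleftrightarrow> (\<exists>x\<in>M. median_bounded M m (orbit G \<phi> x))"

definition translates ::
    "('g, 'c) monoid_scheme \<Rightarrow> ('g \<Rightarrow> 'a \<Rightarrow> 'a) \<Rightarrow> 'a set \<Rightarrow> 'a set set" where
  "translates G \<phi> H = {\<phi> g ` H | g. g \<in> carrier G}"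

text \<open>
  The quantifier over base points is universal on purpose. The requirement for a single
  base point is weaker: let \<open>T\<close> be the star-shaped tree with centre \<open>c\<close> and leaves
  \<open>0, 1, 2, \<dots>\<close>, let \<open>Sym(\<nat>) \<times> \<int>\<close> act on \<open>T \<times> \<int>\<close>, and let \<open>H = {0} \<times> \<int>\<close>. The orbit of
  \<open>(0, 0)\<close> meets both \<open>H\<close> and its complement in unbounded sets, and \<open>H\<close> has infinitely many
  translates, but the orbit of \<open>(c, 0)\<close> misses \<open>H\<close>, and every point lies in at most one
  translate of \<open>H\<close>.
\<close>

definition cuts_properly ::
    "('g, 'c) monoid_scheme \<Rightarrow> 'a set \<Rightarrow> ('g \<Rightarrow> 'a \<Rightarrow> 'a) \<Rightarrow> ('a \<Rightarrow> 'a \<Rightarrow> 'a \<Rightarrow> 'a)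
      \<Rightarrow> 'a set \<Rightarrow> bool" where
  "cuts_properly G M \<phi> m H \<longleftrightarrow>
    (\<forall>x\<in>M. \<not> median_bounded M m (H \<inter> orbit G \<phi> x) \<and>
           \<not> median_bounded M m ((M - H) \<inter> orbit G \<phi> x))"

definition essential ::
    "('g, 'c) monoid_scheme \<Rightarrow> 'a set \<Rightarrow> ('g \<Rightarrow> 'a \<Rightarrow> 'a) \<Rightarrow> ('a \<Rightarrow> 'a \<Rightarrow> 'a \<Rightarrow> 'a)
      \<Rightarrow> 'a set \<Rightarrow> bool" where
  "essential G M \<phi> m H \<longleftrightarrow> infinite (translates G \<phi> H) \<and> cuts_properly G M \<phi> m H"

section \<open>The quotient determined by the orbit of a half space\<close>

definition hyperplane_orbit ::
    "('g, 'c) monoid_scheme \<Rightarrow> 'a set \<Rightarrow> ('g \<Rightarrow> 'a \<Rightarrow> 'a) \<Rightarrow> 'a set \<Rightarrow> 'a set set set" where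
  "hyperplane_orbit G M \<phi> H = {(\<lambda>J. \<phi> g ` J) ` hyperplane M H | g. g \<in> carrier G}"

definition orbit_dist ::
    "('g, 'c) monoid_scheme \<Rightarrow> 'a set \<Rightarrow> ('g \<Rightarrow> 'a \<Rightarrow> 'a) \<Rightarrow> ('a \<Rightarrow> 'a \<Rightarrow> 'a \<Rightarrow> 'a)
      \<Rightarrow> 'a set \<Rightarrow> 'a \<Rightarrow> 'a \<Rightarrow> nat" where
  "orbit_dist G M \<phi> m H x y =
    card (separating_hyperplanes M m x y \<inter> hyperplane_orbit G M \<phi> H)"

definition orbit_cong ::
    "('g, 'c) monoid_scheme \<Rightarrow> 'a set \<Rightarrow> ('g \<Rightarrow> 'a \<Rightarrow> 'a) \<Rightarrow> ('a \<Rightarrow> 'a \<Rightarrow> 'a \<Rightarrow> 'a)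
      \<Rightarrow> 'a set \<Rightarrow> ('a \<times> 'a) set" where
  "orbit_cong G M \<phi> m H = {(x, y). x \<in> M \<and> y \<in> M \<and> orbit_dist G M \<phi> m H x y = 0}"

definition quotient_carrier ::
    "('g, 'c) monoid_scheme \<Rightarrow> 'a set \<Rightarrow> ('g \<Rightarrow> 'a \<Rightarrow> 'a) \<Rightarrow> ('a \<Rightarrow> 'a \<Rightarrow> 'a \<Rightarrow> 'a)
      \<Rightarrow> 'a set \<Rightarrow> 'a set set" where
  "quotient_carrier G M \<phi> m H = M // orbit_cong G M \<phi> m H"

definition quotient_median ::
    "('g, 'c) monoid_scheme \<Rightarrow> 'a set \<Rightarrow> ('g \<Rightarrow> 'a \<Rightarrow> 'a) \<Rightarrow> ('a \<Rightarrow> 'a \<Rightarrow> 'a \<Rightarrow> 'a)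
      \<Rightarrow> 'a set \<Rightarrow> 'a set \<Rightarrow> 'a set \<Rightarrow> 'a set \<Rightarrow> 'a set" where
  "quotient_median G M \<phi> m H X Y Z =
    (\<Union>x\<in>X. \<Union>y\<in>Y. \<Union>z\<in>Z. orbit_cong G M \<phi> m H `` {m x y z})"

definition quotient_action ::
    "('g, 'c) monoid_scheme \<Rightarrow> 'a set \<Rightarrow> ('g \<Rightarrow> 'a \<Rightarrow> 'a) \<Rightarrow> ('a \<Rightarrow> 'a \<Rightarrow> 'a \<Rightarrow> 'a)
      \<Rightarrow> 'a set \<Rightarrow> 'g \<Rightarrow> 'a set \<Rightarrow> 'a set" where
  "quotient_action G M \<phi> m H g = (\<lambda>X \<in> quotient_carrier G M \<phi> m H. \<phi> g ` X)"

end

theory Submission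
  imports Defs
begin

text \<open>
  Each condition turns out to be equivalent to: for every, equivalently for some, base point
  \<open>x\<close> the displacement \<open>d x (gx)\<close> is unbounded in \<open>g\<close>, where \<open>d\<close> counts separating hyper
  planes in the orbit of \<open>H\<close>. Independence of the base point is the triangle inequality,
  since \<open>d\<close> is an invariant pseudometric.

  For (iv) one needs that the median metric of the quotient is \<open>d\<close>. The point is that the
  quotient has no half spaces besides the obvious ones. Every proper half space \<open>K\<close> of a
  discrete median algebra is the only half space that separates some pair of points
  (\<open>exists_pair_separated_only_by\<close>); if \<open>K\<close> comes from the quotient, then this pair is not
  identified there, so \<open>K\<close> or its complement is a translate of \<open>H\<close>.

  For (ii), let \<open>A\<close> be the set of translates of \<open>H\<close> that contain \<open>x\<close>, a subset of the
  transitive \<open>G\<close>-set of all translates. If \<open>A\<close> or its complement is finite, then \<open>d x (gx)\<close>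
  is at most twice its size. Conversely, a bound on \<open>d x (gx)\<close> bounds
  \<open>A \<triangle> gA\<close> uniformly in \<open>g\<close>. In an infinite transitive \<open>G\<close>-set
  such an \<open>A\<close> must be finite or cofinite
  (\<open>finite_or_cofinite_if_bounded_displacement\<close>). This purely combinatorial fact replaces a
  fixed point theorem for bounded orbits. It rests on the separation lemma of P. M. Neumann:
  if all orbits are infinite, some group element moves a given finite set off another one.

  For (i), suppose that infinitely many translates contain \<open>x\<close> and let \<open>gx\<close> be far from
  \<open>x\<close>. If \<open>H \<inter> Gx\<close> were bounded, no translate could contain both points, so infinitely many
  would separate them. Suppose on the other hand that only finitely many translates contain
  \<open>x\<close>. The separation lemma gives \<open>g\<close> and \<open>h\<close> such that no translate contains two of
  \<open>x\<close>, \<open>gx\<close>, \<open>hx\<close>. Their median lies in no translate at all, its orbit misses \<open>H\<close>, and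
  \<open>H\<close> does not cut properly. The statements about the complement of \<open>H\<close> follow by applying
  those about \<open>H\<close> to it.
\<close>

section \<open>Infinite orbits and almost invariant sets\<close>

context group_action
begin

lemma group_G: "group G"
  using group_hom group_hom.axioms(1) by blast

lemma act_closed: "\<lbrakk>g \<in> carrier G; x \<in> E\<rbrakk> \<Longrightarrow> \<phi> g x \<in> E"
  using element_image by blast

lemma act_one: "x \<in> E \<Longrightarrow> \<phi> \<one> x = x"
  by (metis id_eq_one restrict_apply')

lemma act_inv_act: "\<lbrakk>g \<in> carrier G; x \<in> E\<rbrakk> \<Longrightarrow> \<phi> (inv g) (\<phi> g x) = x"
  using orbit_sym_aux by blast

lemma act_act_inv: "\<lbrakk>g \<in> carrier G; x \<in> E\<rbrakk> \<Longrightarrow> \<phi> g (\<phi> (inv g) x) = x"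
  by (metis act_inv_act group_G group.inv_closed group.inv_inv)

lemma act_image_mult:
  assumes "g \<in> carrier G" "h \<in> carrier G" "C \<subseteq> E"
  shows "\<phi> (g \<otimes> h) ` C = \<phi> g ` \<phi> h ` C"
proof -
  have "\<phi> (g \<otimes> h) ` C = (\<lambda>x. \<phi> g (\<phi> h x)) ` C"
    using assms by (intro image_cong refl composition_rule) auto
  then show ?thesis by (simp add: image_image)
qed

lemma act_mem_image_iff:
  assumes "g \<in> carrier G" "C \<subseteq> E" "x \<in> E"
  shows "x \<in> \<phi> g ` C \<longleftrightarrow> \<phi> (inv g) x \<in> C"
proof
  assume "x \<in> \<phi> g ` C"
  then obtain c where "c \<in> C" "x = \<phi> g c" by blast
  then show "\<phi> (inv g) x \<in> C"
    using assms(1,2) act_inv_act[of g c] by auto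
next
  assume "\<phi> (inv g) x \<in> C"
  then have "\<phi> g (\<phi> (inv g) x) \<in> \<phi> g ` C" by (rule imageI)
  then show "x \<in> \<phi> g ` C"
    using act_act_inv[OF assms(1,3)] by simp
qed

lemma act_mem_image_act_iff:
  assumes "g \<in> carrier G" "C \<subseteq> E" "x \<in> E"
  shows "\<phi> g x \<in> \<phi> g ` C \<longleftrightarrow> x \<in> C"
  using assms by (simp add: act_mem_image_iff act_closed act_inv_act)

text \<open>
  Induction on \<open>\<Gamma>\<close>. To move one more point \<open>\<gamma>\<close> off \<open>\<Delta>\<close>, fix for each \<open>\<delta> \<in> \<Delta>\<close> some
  \<open>t\<^sub>\<delta>\<close> that moves \<open>\<delta>\<close> out of \<open>\<Delta>\<close>, and choose \<open>g\<close> by the induction hypothesis so that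
  it moves \<open>\<Gamma>\<close> off \<open>\<Delta>\<close> and off all \<open>t\<^sub>\<delta>\<inverse>\<Delta>\<close>. Then \<open>g\<close> itself works, unless it
  sends \<open>\<gamma>\<close> to some \<open>\<delta> \<in> \<Delta>\<close>; in that case \<open>t\<^sub>\<delta> g\<close> works.
\<close>

lemma exists_disjoint_translate:
  assumes "finite \<Gamma>" "\<Gamma> \<subseteq> E" "finite \<Delta>"
    and inf: "\<And>x. x \<in> E \<Longrightarrow> infinite (orbit G \<phi> x)"
  shows "\<exists>g\<in>carrier G. \<phi> g ` \<Gamma> \<inter> \<Delta> = {}"
  using assms(1-3)
proof (induction \<Gamma> arbitrary: \<Delta>)
  case empty
  interpret group G by (rule group_G)
  show ?case by auto
next
  case (insert \<gamma> \<Gamma>)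
  interpret group G by (rule group_G)
  have "\<forall>\<delta>\<in>\<Delta> \<inter> E. \<exists>t\<in>carrier G. \<phi> t \<delta> \<notin> \<Delta>"
  proof
    fix \<delta> assume "\<delta> \<in> \<Delta> \<inter> E"
    then have "\<not> orbit G \<phi> \<delta> \<subseteq> \<Delta>"
      using inf \<open>finite \<Delta>\<close> finite_subset by blast
    then show "\<exists>t\<in>carrier G. \<phi> t \<delta> \<notin> \<Delta>"
      unfolding orbit_def by blast
  qed
  then obtain t where t: "\<And>\<delta>. \<delta> \<in> \<Delta> \<inter> E \<Longrightarrow> t \<delta> \<in> carrier G \<and> \<phi> (t \<delta>) \<delta> \<notin> \<Delta>"
    by metis
  let ?\<Delta>' = "\<Delta> \<union> (\<Union>\<delta>\<in>\<Delta> \<inter> E. \<phi> (inv (t \<delta>)) ` (\<Delta> \<inter> E))"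
  have "finite ?\<Delta>'"
    using \<open>finite \<Delta>\<close> by blast
  then obtain g where g: "g \<in> carrier G" "\<phi> g ` \<Gamma> \<inter> ?\<Delta>' = {}"
    using insert.IH insert.prems(1) by (meson insert_subset)
  show ?case
  proof (cases "\<phi> g \<gamma> \<in> \<Delta>")
    case False
    then show ?thesis using g by blast
  next
    case True
    define \<delta> where "\<delta> = \<phi> g \<gamma>"
    have \<delta>: "\<delta> \<in> \<Delta> \<inter> E"
      using True g(1) insert.prems(1) act_closed by (auto simp: \<delta>_def)
    have "\<phi> (t \<delta> \<otimes> g) x \<notin> \<Delta>" if x: "x \<in> insert \<gamma> \<Gamma>" for x
    proof
      have xE: "x \<in> E" using x insert.prems(1) by blast
      assume a: "\<phi> (t \<delta> \<otimes> g) x \<in> \<Delta>"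
      then have *: "\<phi> (t \<delta>) (\<phi> g x) \<in> \<Delta> \<inter> E"
        using composition_rule[OF xE] t[OF \<delta>] g(1) xE act_closed by auto
      show False
      proof (cases "x = \<gamma>")
        case True
        then show False using * t[OF \<delta>] by (simp add: \<delta>_def)
      next
        case False
        then have "x \<in> \<Gamma>" using x by blast
        moreover have "\<phi> g x = \<phi> (inv (t \<delta>)) (\<phi> (t \<delta>) (\<phi> g x))"
          using act_inv_act t[OF \<delta>] g(1) xE act_closed by metis
        ultimately show False using * \<delta> g(2) by blast
      qed
    qed
    then show ?thesis
      using t[OF \<delta>] g(1) by (intro bexI[of _ "t \<delta> \<otimes> g"]) auto
  qed
qed

end

text \<open>
  Count a point outside \<open>F \<union> F'\<close> in the four differences between a set of \<open>{A, A'}\<close> and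
  one of \<open>{B, B'}\<close>. Each point of \<open>F\<close> lies in exactly two of the four, and so does each
  point of \<open>F'\<close>, so \<open>F\<close> and \<open>F'\<close> already use up the total size \<open>4 |F|\<close> that is
  available; a point of \<open>A \<triangle> B\<close> outside \<open>F \<union> F'\<close> would lie in all four.
\<close>

lemma sym_diff_subset_if_extremal:
  fixes A A' B B' :: "'b set"
  defines "F \<equiv> sym_diff A A'" and "F' \<equiv> sym_diff B B'"
  assumes disj: "F \<inter> F' = {}"
    and fin: "finite F" "finite F'" "card F' = card F"
    and bound: "\<And>X Y. \<lbrakk>X \<in> {A, A'}; Y \<in> {B, B'}\<rbrakk>
        \<Longrightarrow> finite (sym_diff X Y) \<and> card (sym_diff X Y) \<le> card F"
  shows "sym_diff A B \<subseteq> F \<union> F'"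
proof (rule ccontr)
  assume "\<not> sym_diff A B \<subseteq> F \<union> F'"
  then obtain p where p: "p \<in> sym_diff A B" "p \<notin> F" "p \<notin> F'"
    by blast
  have lower: "card (sym_diff X Y \<inter> F) + card (sym_diff X Y \<inter> F') + 1 \<le> card F"
    if XY: "X \<in> {A, A'}" "Y \<in> {B, B'}" for X Y
  proof -
    let ?S = "sym_diff X Y"
    have "p \<in> ?S"
      using p XY unfolding F_def F'_def by blast
    then have "insert p ((?S \<inter> F) \<union> (?S \<inter> F')) \<subseteq> ?S"
      by blast
    then have "card (insert p ((?S \<inter> F) \<union> (?S \<inter> F'))) \<le> card ?S"
      by (rule card_mono[OF conjunct1[OF bound[OF XY]]])
    moreover have "card (insert p ((?S \<inter> F) \<union> (?S \<inter> F'))) = Suc (card ((?S \<inter> F) \<union> (?S \<inter> F')))"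
      using p fin by (intro card_insert_disjoint) auto
    moreover have "card ((?S \<inter> F) \<union> (?S \<inter> F')) = card (?S \<inter> F) + card (?S \<inter> F')"
      using fin disj by (intro card_Un_disjoint) auto
    ultimately show ?thesis using bound[OF XY] by linarith
  qed
  have split_F: "card (sym_diff A Y \<inter> F) + card (sym_diff A' Y \<inter> F) = card F" for Y
  proof -
    have "(sym_diff A Y \<inter> F) \<union> (sym_diff A' Y \<inter> F) = F"
      and "(sym_diff A Y \<inter> F) \<inter> (sym_diff A' Y \<inter> F) = {}"
      unfolding F_def by blast+
    then show ?thesis
      using card_Un_disjoint[of "sym_diff A Y \<inter> F" "sym_diff A' Y \<inter> F"] fin(1) by simp
  qed
  have split_F': "card (sym_diff X B \<inter> F') + card (sym_diff X B' \<inter> F') = card F'" for X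
  proof -
    have "(sym_diff X B \<inter> F') \<union> (sym_diff X B' \<inter> F') = F'"
      and "(sym_diff X B \<inter> F') \<inter> (sym_diff X B' \<inter> F') = {}"
      unfolding F'_def by blast+
    then show ?thesis
      using card_Un_disjoint[of "sym_diff X B \<inter> F'" "sym_diff X B' \<inter> F'"] fin(2) by simp
  qed
  show False
    using lower[of A B] lower[of A B'] lower[of A' B] lower[of A' B']
      split_F[of B] split_F[of B'] split_F'[of A] split_F'[of A'] fin(3) by simp
qed

text \<open>
  Choose \<open>g\<close> with \<open>F = A \<triangle> gA\<close> as large as possible. Whenever \<open>hF\<close> is disjoint from
  \<open>F\<close>, extremality forces \<open>A \<triangle> hA \<subseteq> F \<union> hF\<close>. If \<open>A\<close> and its complement were both
  infinite, there would be \<open>p \<in> A\<close> and \<open>q = tp \<notin> A\<close> outside \<open>F\<close>. An element \<open>h\<close> that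
  moves \<open>F\<close>, \<open>tF\<close> and \<open>q\<close> off \<open>F\<close> sends \<open>q\<close> outside \<open>A\<close>, by the inclusion for \<open>h\<close>, and
  into \<open>A\<close>, by the inclusion for \<open>ht\<close>, because \<open>hq = (ht)p\<close>.
\<close>

lemma (in transitive_action) finite_or_cofinite_if_bounded_displacement:
  assumes E: "infinite E" and A: "A \<subseteq> E"
    and bound: "\<And>g. g \<in> carrier G \<Longrightarrow>
      finite (sym_diff A (\<phi> g ` A)) \<and> card (sym_diff A (\<phi> g ` A)) \<le> N"
  shows "finite A \<or> finite (E - A)"
proof (rule ccontr)
  assume contra: "\<not> (finite A \<or> finite (E - A))"
  interpret group G by (rule group_G)
  let ?D = "\<lambda>g. sym_diff A (\<phi> g ` A)"
  have inf: "infinite (orbit G \<phi> x)" if "x \<in> E" for x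
  proof -
    have "E \<subseteq> orbit G \<phi> x"
      using unique_orbit[OF that] unfolding orbit_def by blast
    then show ?thesis using E finite_subset by blast
  qed
  have "\<exists>g. g \<in> carrier G \<and> (\<forall>h. h \<in> carrier G \<longrightarrow> card (?D h) \<le> card (?D g))"
    using bound by (intro ex_has_greatest_nat[of _ \<one> _ "Suc N"]) (auto simp: less_Suc_eq_le)
  then obtain g where g: "g \<in> carrier G"
    and gmax: "\<And>h. h \<in> carrier G \<Longrightarrow> card (?D h) \<le> card (?D g)"
    by blast
  define F where "F = ?D g"
  have img: "\<phi> g ` A \<subseteq> E" if "g \<in> carrier G" for g
    using A surj_prop[OF that] by blast
  have FE: "F \<subseteq> E" and finF: "finite F"
    using A img[OF g] bound[OF g] unfolding F_def by blast+
  have image_sym_diff: "\<phi> h ` sym_diff X Y = sym_diff (\<phi> h ` X) (\<phi> h ` Y)"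
    if "h \<in> carrier G" "X \<subseteq> E" "Y \<subseteq> E" for h X Y
  proof -
    have "\<phi> h ` (X - Y) = \<phi> h ` X - \<phi> h ` Y" "\<phi> h ` (Y - X) = \<phi> h ` Y - \<phi> h ` X"
      using inj_on_image_set_diff[OF inj_prop[OF that(1)]] that(2,3) by blast+
    then show ?thesis by (simp add: image_Un)
  qed
  have card_image: "card (\<phi> h ` X) = card X" if "h \<in> carrier G" "X \<subseteq> E" for h X
    by (meson card_image inj_on_subset inj_prop that)
  have pair_bound: "finite (sym_diff (\<phi> a ` A) (\<phi> b ` A)) \<and>
      card (sym_diff (\<phi> a ` A) (\<phi> b ` A)) \<le> card F"
    if a: "a \<in> carrier G" and b: "b \<in> carrier G" for a b
  proof -
    let ?c = "inv a \<otimes> b"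
    have c: "?c \<in> carrier G" using a b by simp
    have "\<phi> b ` A = \<phi> a ` \<phi> ?c ` A"
      using a b A act_image_mult[OF a c A] by (simp add: m_assoc[symmetric])
    then have "sym_diff (\<phi> a ` A) (\<phi> b ` A) = \<phi> a ` ?D ?c"
      using image_sym_diff[OF a A img[OF c]] by simp
    moreover have "?D ?c \<subseteq> E"
      using A img[OF c] by blast
    ultimately show ?thesis
      using card_image[OF a] bound[OF c] gmax[OF c] unfolding F_def by simp
  qed
  have key: "?D h \<subseteq> F \<union> \<phi> h ` F" if h: "h \<in> carrier G" and disj: "F \<inter> \<phi> h ` F = {}" for h
  proof -
    have hF: "\<phi> h ` F = sym_diff (\<phi> h ` A) (\<phi> (h \<otimes> g) ` A)"
      unfolding F_def using image_sym_diff[OF h A img[OF g]] act_image_mult[OF h g A] by simp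
    have one: "A = \<phi> \<one> ` A"
      using A act_one by (force simp: subset_iff)
    have "sym_diff A (\<phi> h ` A)
        \<subseteq> sym_diff A (\<phi> g ` A) \<union> sym_diff (\<phi> h ` A) (\<phi> (h \<otimes> g) ` A)"
    proof (rule sym_diff_subset_if_extremal)
      show "sym_diff A (\<phi> g ` A) \<inter> sym_diff (\<phi> h ` A) (\<phi> (h \<otimes> g) ` A) = {}"
        using disj unfolding hF unfolding F_def .
      show "finite (sym_diff A (\<phi> g ` A))"
        using finF unfolding F_def .
      show "finite (sym_diff (\<phi> h ` A) (\<phi> (h \<otimes> g) ` A))"
        using finF unfolding hF[symmetric] by simp
      show "card (sym_diff (\<phi> h ` A) (\<phi> (h \<otimes> g) ` A)) = card (sym_diff A (\<phi> g ` A))"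
        using card_image[OF h FE] unfolding hF[symmetric] F_def[symmetric] .
      fix X Y assume "X \<in> {A, \<phi> g ` A}" "Y \<in> {\<phi> h ` A, \<phi> (h \<otimes> g) ` A}"
      then obtain a b where "a \<in> carrier G" "X = \<phi> a ` A" "b \<in> carrier G" "Y = \<phi> b ` A"
        using g h one by blast
      then show "finite (sym_diff X Y) \<and> card (sym_diff X Y) \<le> card (sym_diff A (\<phi> g ` A))"
        using pair_bound unfolding F_def by simp
    qed
    then show ?thesis unfolding hF unfolding F_def .
  qed
  obtain p where p: "p \<in> A" "p \<notin> F"
    using contra finF by (meson finite_subset subsetI)
  obtain q where q: "q \<in> E" "q \<notin> A" "q \<notin> F"
    using contra finF by (metis DiffD1 DiffD2 finite_subset subsetI)
  have pE: "p \<in> E" using p A by blast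
  obtain t where t: "t \<in> carrier G" "\<phi> t p = q"
    using unique_orbit[OF pE q(1)] by blast
  let ?P = "F \<union> \<phi> t ` F \<union> {q}"
  have "?P \<subseteq> E"
    using FE q(1) act_closed[OF t(1)] by auto
  then obtain h where h: "h \<in> carrier G" "\<phi> h ` ?P \<inter> F = {}"
    using exists_disjoint_translate[of ?P F] finF inf by auto
  have hqF: "\<phi> h q \<notin> F" using h(2) by blast
  have "\<phi> h q \<notin> A"
  proof
    assume "\<phi> h q \<in> A"
    moreover have "\<phi> h q \<notin> \<phi> h ` A"
      using act_mem_image_act_iff[OF h(1) A q(1)] q(2) by simp
    ultimately have "\<phi> h q \<in> F \<union> \<phi> h ` F"
      using key[OF h(1)] h(2) by blast
    then show False
      using hqF act_mem_image_act_iff[OF h(1) FE q(1)] q(3) by simp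
  qed
  moreover have "\<phi> h q \<in> A"
  proof (rule ccontr)
    have ht: "h \<otimes> t \<in> carrier G" using h(1) t(1) by simp
    have htp: "\<phi> (h \<otimes> t) p = \<phi> h q"
      using composition_rule[OF pE h(1) t(1)] t(2) by simp
    have htF: "\<phi> (h \<otimes> t) ` F = \<phi> h ` \<phi> t ` F"
      by (rule act_image_mult[OF h(1) t(1) FE])
    assume "\<phi> h q \<notin> A"
    moreover have "\<phi> h q \<in> \<phi> (h \<otimes> t) ` A"
      using htp p(1) by (metis imageI)
    ultimately have "\<phi> h q \<in> F \<union> \<phi> (h \<otimes> t) ` F"
      using key[OF ht] h(2) htF by blast
    then show False
      using hqF act_mem_image_act_iff[OF ht FE pE] p(2) htp by simp
  qed
  ultimately show False by blast
qed

text \<open>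
  This makes the results on transitive actions available for families of translates, as
  subsets of a single transitive \<open>G\<close>-set.
\<close>

lemma (in group_action) transitive_action_on_translates:
  assumes C: "C \<subseteq> E"
  shows "transitive_action G (translates G \<phi> C) (\<lambda>g. \<lambda>J\<in>translates G \<phi> C. \<phi> g ` J)"
proof -
  interpret group G by (rule group_G)
  let ?T = "translates G \<phi> C" and ?\<psi> = "\<lambda>g. \<lambda>J\<in>translates G \<phi> C. \<phi> g ` J"
  have sub: "J \<subseteq> E" if J: "J \<in> ?T" for J
  proof -
    obtain g where "g \<in> carrier G" "J = \<phi> g ` C"
      using J by (auto simp: translates_def)
    then show ?thesis using C by (auto intro!: act_closed)
  qed
  have closed: "\<phi> g ` J \<in> ?T" if g: "g \<in> carrier G" and J: "J \<in> ?T" for g J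
  proof -
    obtain h where "h \<in> carrier G" "J = \<phi> h ` C"
      using J by (auto simp: translates_def)
    then show ?thesis
      using act_image_mult[OF g _ C] monoid.m_closed[OF is_monoid g]
      by (auto simp: translates_def intro!: exI[of _ "g \<otimes> h"])
  qed
  have cancel: "\<phi> (inv g) ` \<phi> g ` J = J" if g: "g \<in> carrier G" and J: "J \<in> ?T" for g J
  proof -
    have "(\<lambda>x. \<phi> (inv g) (\<phi> g x)) ` J = (\<lambda>x. x) ` J"
      using act_inv_act[OF g] sub[OF J] by (intro image_cong refl) blast
    then show ?thesis by (simp add: image_image)
  qed
  have cancel': "\<phi> g ` \<phi> (inv g) ` J = J" if "g \<in> carrier G" "J \<in> ?T" for g J
    using cancel[of "inv g" J] that by simp
  have bij: "?\<psi> g \<in> Bij ?T" if g: "g \<in> carrier G" for g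
  proof -
    have "bij_betw (?\<psi> g) ?T ?T"
      using closed[OF g] closed[of "inv g"] cancel[OF g] cancel'[OF g] g
      by (intro bij_betw_byWitness[where f' = "?\<psi> (inv g)"]) (simp_all add: image_subset_iff)
    then show ?thesis unfolding Bij_def by simp
  qed
  have mult: "?\<psi> (g \<otimes> h) = compose ?T (?\<psi> g) (?\<psi> h)"
    if "g \<in> carrier G" "h \<in> carrier G" for g h
    using that by (intro ext) (simp add: compose_def closed act_image_mult sub)
  have C_translate: "C \<in> ?T"
  proof -
    have "\<phi> \<one> ` C = (\<lambda>x. x) ` C"
      using act_one C by (intro image_cong refl) blast
    then show ?thesis
      unfolding translates_def by (auto intro!: exI[of _ \<one>])
  qed
  have "?\<psi> \<in> hom G (BijGroup ?T)"
    by (rule homI) (simp_all add: BijGroup_def bij mult)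
  then have "group_hom G (BijGroup ?T) ?\<psi>"
    by (intro group_hom.intro group_hom_axioms.intro group_BijGroup group_G)
  moreover have "\<exists>g\<in>carrier G. ?\<psi> g J = K" if J: "J \<in> ?T" and K: "K \<in> ?T" for J K
  proof -
    obtain g h where gh: "g \<in> carrier G" "J = \<phi> g ` C" "h \<in> carrier G" "K = \<phi> h ` C"
      using J K by (auto simp: translates_def)
    have "\<phi> (h \<otimes> inv g) ` J = K"
      using gh sub[OF J] act_image_mult[of h "inv g" J] cancel[OF gh(1) C_translate] by simp
    then show ?thesis
      using gh(1,3) J by (intro bexI[of _ "h \<otimes> inv g"]) auto
  qed
  ultimately show ?thesis
    by (intro transitive_action.intro group_action.intro transitive_action_axioms.intro)
qed

section \<open>Half spaces of median algebras\<close>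

lemma halfspace_complement: "halfspace M m J \<Longrightarrow> halfspace M m (M - J)"
  unfolding halfspace_def by (auto simp: double_diff)

lemma hyperplane_complement: "J \<subseteq> M \<Longrightarrow> hyperplane M (M - J) = hyperplane M J"
  unfolding hyperplane_def by (simp add: double_diff insert_commute)

context median_algebra
begin

lemma median_in_interval:
  assumes "x \<in> M" "y \<in> M" "z \<in> M"
  shows "m x y z \<in> interval M m x y"
proof -
  have "m x y (m x y z) = m (m z x y) x y"
    using assms closed rotate by metis
  also have "\<dots> = m z (m x x y) (m y x y)"
    using assms by (simp add: distrib)
  also have "\<dots> = m z x y"
    using assms majority swap rotate by metis
  also have "\<dots> = m x y z"
    using assms by (simp add: rotate)
  finally show ?thesis
    using assms closed by (simp add: interval_def)
qed

lemma median_mem_halfspace_if_two: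
  assumes J: "halfspace M m J" and xyz: "x \<in> M" "y \<in> M" "z \<in> M"
    and two: "x \<in> J \<and> y \<in> J \<or> x \<in> J \<and> z \<in> J \<or> y \<in> J \<and> z \<in> J"
  shows "m x y z \<in> J"
proof -
  have *: "m a b c \<in> J" if "a \<in> J" "b \<in> J" "c \<in> M" for a b c
    using J that median_in_interval[of a b c]
    unfolding halfspace_def median_convex_def by blast
  show ?thesis
    using two *[of x y z] *[of x z y] *[of y z x] swap rotate xyz by metis
qed

lemma median_mem_halfspace_iff:
  assumes J: "halfspace M m J" and xyz: "x \<in> M" "y \<in> M" "z \<in> M"
  shows "m x y z \<in> J \<longleftrightarrow> x \<in> J \<and> y \<in> J \<or> x \<in> J \<and> z \<in> J \<or> y \<in> J \<and> z \<in> J"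
  using median_mem_halfspace_if_two[OF J xyz]
    median_mem_halfspace_if_two[OF halfspace_complement[OF J] xyz] xyz
  by auto

end

text \<open>
  Take \<open>x \<in> K\<close> and \<open>y \<notin> K\<close> with as few separating half spaces as possible. If a second
  half space \<open>J\<close> separated them, then a point \<open>z\<close> in which \<open>J\<close> and \<open>K\<close> differ would give
  the point \<open>m x y z\<close> of \<open>[x,y]\<close>, which can replace \<open>x\<close> or \<open>y\<close> and is no longer
  separated by \<open>J\<close>.
\<close>

lemma (in discrete_median_algebra) exists_pair_separated_only_by:
  assumes K: "proper_halfspace M m K"
  shows "\<exists>x\<in>K. \<exists>y\<in>M - K. separators M m x y = {K}"
proof -
  have hs: "halfspace M m K" and KM: "K \<subseteq> M"
    using K by (auto simp: proper_halfspace_def halfspace_def)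
  let ?P = "\<lambda>p. fst p \<in> K \<and> snd p \<in> M - K"
  let ?f = "\<lambda>p. card (separators M m (fst p) (snd p))"
  have "\<exists>p. ?P p"
    using K KM by (auto simp: proper_halfspace_def)
  then obtain p where p: "?P p" "\<And>q. ?P q \<Longrightarrow> ?f p \<le> ?f q"
    using ex_has_least_nat[of ?P _ ?f] by blast
  define x y where "x = fst p" and "y = snd p"
  have x: "x \<in> K" "x \<in> M" and y: "y \<notin> K" "y \<in> M"
    using p(1) KM by (auto simp: x_def y_def)
  have min: "card (separators M m x y) \<le> card (separators M m a b)"
    if "a \<in> K" "b \<in> M - K" for a b
    using p(2)[of "(a, b)"] that by (simp add: x_def y_def)
  have no_smaller: False
    if "a \<in> K" "b \<in> M - K" "separators M m a b \<subset> separators M m x y" for a b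
    using min[OF that(1,2)] psubset_card_mono[OF discrete[OF x(2) y(2)] that(3)] by linarith
  have "J = K" if J: "J \<in> separators M m x y" for J
  proof (rule ccontr)
    assume "J \<noteq> K"
    have Jhs: "halfspace M m J" and JM: "J \<subseteq> M" and xJ: "x \<in> J" and yJ: "y \<notin> J"
      using J by (auto simp: separators_def halfspace_def)
    consider z where "z \<in> K" "z \<notin> J" | z where "z \<in> J" "z \<notin> K"
      using \<open>J \<noteq> K\<close> by blast
    then show False
    proof cases
      case 1
      then have zM: "z \<in> M" using KM by blast
      have "m x y z \<in> K" and "m x y z \<notin> J"
        using 1 x y xJ yJ zM median_mem_halfspace_iff[OF hs] median_mem_halfspace_iff[OF Jhs]
        by simp_all
      moreover have "separators M m (m x y z) y \<subseteq> separators M m x y"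
        using x y zM by (auto simp: separators_def median_mem_halfspace_iff)
      ultimately show False
        using no_smaller[of "m x y z" y] J y by (auto simp: separators_def)
    next
      case 2
      then have zM: "z \<in> M" using JM by blast
      have "m x y z \<in> M - K" and "m x y z \<in> J"
        using 2 x y xJ yJ zM closed
          median_mem_halfspace_iff[OF hs] median_mem_halfspace_iff[OF Jhs]
        by simp_all
      moreover have "separators M m x (m x y z) \<subseteq> separators M m x y"
        using x y zM by (auto simp: separators_def median_mem_halfspace_iff)
      ultimately show False
        using no_smaller[of x "m x y z"] J x by (auto simp: separators_def)
    qed
  qed
  moreover have "K \<in> separators M m x y"
    using hs x y by (simp add: separators_def)
  ultimately have "separators M m x y = {K}" by blast
  then show ?thesis using x y by blast
qed

lemma (in discrete_median_action) halfspace_image: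
  assumes g: "g \<in> carrier G" and J: "halfspace M m J"
  shows "halfspace M m (\<phi> g ` J)"
proof -
  have convex_image: "median_convex M m (\<phi> g ` C)" if C: "median_convex M m C" for C
  proof -
    have CM: "C \<subseteq> M" using C by (simp add: median_convex_def)
    have "z \<in> \<phi> g ` C"
      if "a \<in> C" "b \<in> C" and z: "z \<in> interval M m (\<phi> g a) (\<phi> g b)" for a b z
    proof -
      have ab: "a \<in> M" "b \<in> M" using that CM by auto
      obtain c where c: "c \<in> M" "z = \<phi> g c"
        using z surj_prop[OF g] by (auto simp: interval_def)
      have "\<phi> g c = \<phi> g (m a b c)"
        using z c g ab by (simp add: interval_def equivariant)
      then have "c = m a b c"
        using inj_prop[OF g] c(1) ab closed by (meson inj_onD)
      then have "c \<in> interval M m a b"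
        using c(1) by (simp add: interval_def)
      then show ?thesis
        using C that c(2) unfolding median_convex_def by blast
    qed
    moreover have "\<phi> g ` C \<subseteq> M"
      using CM surj_prop[OF g] by blast
    ultimately show ?thesis
      unfolding median_convex_def by blast
  qed
  have JM: "J \<subseteq> M" using J by (simp add: halfspace_def)
  have "\<phi> g ` (M - J) = M - \<phi> g ` J"
    using inj_on_image_set_diff[OF inj_prop[OF g], of M J] surj_prop[OF g] JM by auto
  then show ?thesis
    using J convex_image[of J] convex_image[of "M - J"] JM surj_prop[OF g]
    unfolding halfspace_def by (auto simp: median_convex_def)
qed

section \<open>The pseudometric of an orbit of hyper planes\<close>

locale halfspace_action = discrete_median_action G M \<phi> m
  for G (structure) and M :: "'a set" and \<phi> m +
  fixes H :: "'a set"
  assumes proper_H: "proper_halfspace M m H"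
begin

sublocale group G
  by (rule group_G)

abbreviation "T \<equiv> translates G \<phi> H"

abbreviation "d \<equiv> orbit_dist G M \<phi> m H"

text \<open>
  Half spaces are easier to handle than the two-element sets that represent hyper planes.
  All statements about \<open>d\<close> therefore go through the half spaces bounded by the hyper planes
  in the orbit of \<open>H\<close>.
\<close>

definition sides :: "'a set set" where
  "sides = translates G \<phi> H \<union> translates G \<phi> (M - H)"

definition side_separators :: "'a \<Rightarrow> 'a \<Rightarrow> 'a set set" where
  "side_separators x y = {J \<in> sides. x \<in> J \<and> y \<notin> J}"

lemma H_halfspace: "halfspace M m H" and H_subset: "H \<subseteq> M"
  using proper_H by (auto simp: proper_halfspace_def halfspace_def)

lemma image_complement:
  assumes "g \<in> carrier G" "J \<subseteq> M"
  shows "\<phi> g ` (M - J) = M - \<phi> g ` J"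
  using inj_on_image_set_diff[OF inj_prop[OF assms(1)], of M J] surj_prop[OF assms(1)] assms(2)
  by auto

lemma translates_complement: "translates G \<phi> (M - H) = (\<lambda>J. M - J) ` T"
proof -
  have "(\<lambda>g. \<phi> g ` (M - H)) ` carrier G = (\<lambda>g. M - \<phi> g ` H) ` carrier G"
    using image_complement[OF _ H_subset] by (intro image_cong refl)
  then show ?thesis
    by (simp add: translates_def Setcompr_eq_image image_image)
qed

lemma translate_halfspace: "J \<in> T \<Longrightarrow> halfspace M m J"
  using halfspace_image H_halfspace by (auto simp: translates_def)

lemma side_halfspace: "J \<in> sides \<Longrightarrow> halfspace M m J"
  using translate_halfspace halfspace_complement by (auto simp: sides_def translates_complement)

lemma translate_subset: "J \<in> T \<Longrightarrow> J \<subseteq> M"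
  using translate_halfspace by (simp add: halfspace_def)

lemma side_subset: "J \<in> sides \<Longrightarrow> J \<subseteq> M"
  using side_halfspace by (simp add: halfspace_def)

lemma side_complement: "J \<in> sides \<Longrightarrow> M - J \<in> sides"
  using translate_subset by (auto simp: sides_def translates_complement double_diff)

lemma translate_image:
  assumes g: "g \<in> carrier G" and J: "J \<in> T"
  shows "\<phi> g ` J \<in> T"
proof -
  obtain h where h: "h \<in> carrier G" "J = \<phi> h ` H"
    using J by (auto simp: translates_def)
  then have "\<phi> g ` J = \<phi> (g \<otimes> h) ` H"
    using act_image_mult[OF g _ H_subset] by simp
  then show ?thesis
    using g h(1) unfolding translates_def by blast
qed

lemma side_image:
  assumes g: "g \<in> carrier G" and J: "J \<in> sides"
  shows "\<phi> g ` J \<in> sides"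
proof -
  consider "J \<in> T" | K where "K \<in> T" "J = M - K"
    using J by (auto simp: sides_def translates_complement)
  then show ?thesis
  proof cases
    case 1
    then show ?thesis
      using translate_image[OF g] by (simp add: sides_def)
  next
    case 2
    then show ?thesis
      using translate_image[OF g 2(1)] image_complement[OF g translate_subset[OF 2(1)]]
      by (simp add: sides_def translates_complement)
  qed
qed

lemma image_inv_image:
  assumes g: "g \<in> carrier G" and J: "J \<subseteq> M"
  shows "\<phi> g ` \<phi> (inv g) ` J = J"
proof -
  have "(\<lambda>x. \<phi> g (\<phi> (inv g) x)) ` J = (\<lambda>x. x) ` J"
    using act_act_inv[OF g] J by (intro image_cong refl) blast
  then show ?thesis by (simp add: image_image)
qed

lemma side_separators_subset: "side_separators x y \<subseteq> separators M m x y"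
  using side_halfspace by (auto simp: side_separators_def separators_def)

lemma finite_side_separators: "\<lbrakk>x \<in> M; y \<in> M\<rbrakk> \<Longrightarrow> finite (side_separators x y)"
  by (rule finite_subset[OF side_separators_subset discrete])

text \<open>
  Of the two sides of a separating hyper plane exactly one contains \<open>x\<close>, so hyper planes
  that separate \<open>x\<close> from \<open>y\<close> can be counted by their side around \<open>x\<close>.
\<close>

lemma orbit_dist_eq: "d x y = card (side_separators x y)"
proof -
  have orb: "hyperplane_orbit G M \<phi> H = hyperplane M ` T"
  proof -
    have "(`) (\<phi> g) ` hyperplane M H = hyperplane M (\<phi> g ` H)" if "g \<in> carrier G" for g
      using image_complement[OF that H_subset] by (simp add: hyperplane_def)
    then show ?thesis
      unfolding hyperplane_orbit_def translates_def Setcompr_eq_image image_image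
      by (intro image_cong refl)
  qed
  have sides: "hyperplane M J \<in> hyperplane M ` T" if "J \<in> sides" for J
    using that translate_subset
    by (auto simp: sides_def translates_complement hyperplane_complement)
  have "separating_hyperplanes M m x y \<inter> hyperplane_orbit G M \<phi> H
      = hyperplane M ` side_separators x y"
  proof (intro equalityI subsetI)
    fix P assume "P \<in> separating_hyperplanes M m x y \<inter> hyperplane_orbit G M \<phi> H"
    then obtain J K where J: "J \<in> separators M m x y" "P = hyperplane M J"
      and K: "K \<in> T" "P = hyperplane M K"
      by (auto simp: separating_hyperplanes_def orb)
    then have "J = K \<or> J = M - K"
      by (auto simp: hyperplane_def doubleton_eq_iff)
    then have "J \<in> sides"
      using K(1) by (auto simp: sides_def translates_complement)
    then show "P \<in> hyperplane M ` side_separators x y"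
      using J by (auto simp: side_separators_def separators_def)
  next
    fix P assume "P \<in> hyperplane M ` side_separators x y"
    then show "P \<in> separating_hyperplanes M m x y \<inter> hyperplane_orbit G M \<phi> H"
      using side_separators_subset sides orb
      by (auto simp: separating_hyperplanes_def side_separators_def)
  qed
  moreover have "inj_on (hyperplane M) (side_separators x y)"
  proof (rule inj_onI)
    fix J K assume "J \<in> side_separators x y" "K \<in> side_separators x y"
      "hyperplane M J = hyperplane M K"
    then show "J = K"
      by (auto simp: side_separators_def hyperplane_def doubleton_eq_iff)
  qed
  ultimately show ?thesis
    by (simp add: orbit_dist_def card_image)
qed

lemma orbit_dist_le_median_dist: "\<lbrakk>x \<in> M; y \<in> M\<rbrakk> \<Longrightarrow> d x y \<le> median_dist M m x y"
  unfolding orbit_dist_eq median_dist_def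
  by (rule card_mono[OF discrete side_separators_subset])

lemma orbit_dist_triangle:
  assumes "x \<in> M" "y \<in> M" "z \<in> M"
  shows "d x z \<le> d x y + d y z"
proof -
  have "card (side_separators x z) \<le> card (side_separators x y \<union> side_separators y z)"
    using assms finite_side_separators
    by (intro card_mono) (auto simp: side_separators_def)
  then show ?thesis
    unfolding orbit_dist_eq by (rule le_trans[OF _ card_Un_le])
qed

lemma orbit_dist_invariant:
  assumes g: "g \<in> carrier G" and x: "x \<in> M" and y: "y \<in> M"
  shows "d (\<phi> g x) (\<phi> g y) = d x y"
proof -
  have "side_separators (\<phi> g x) (\<phi> g y) = (`) (\<phi> g) ` side_separators x y"
  proof (intro equalityI subsetI)
    fix J assume J: "J \<in> side_separators (\<phi> g x) (\<phi> g y)"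
    let ?K = "\<phi> (inv g) ` J"
    have K: "?K \<in> sides" "J = \<phi> g ` ?K"
      using J g side_image[of "inv g" J] image_inv_image[OF g side_subset]
      by (simp_all add: side_separators_def)
    have "\<phi> g x \<in> \<phi> g ` ?K" "\<phi> g y \<notin> \<phi> g ` ?K"
      using J K(2) by (simp_all add: side_separators_def)
    then have "?K \<in> side_separators x y"
      using K(1) act_mem_image_act_iff[OF g side_subset[OF K(1)]] x y
      by (simp add: side_separators_def)
    then show "J \<in> (`) (\<phi> g) ` side_separators x y"
      using K(2) by blast
  next
    fix J assume "J \<in> (`) (\<phi> g) ` side_separators x y"
    then obtain K where K: "K \<in> sides" "x \<in> K" "y \<notin> K" "J = \<phi> g ` K"
      by (auto simp: side_separators_def)
    then show "J \<in> side_separators (\<phi> g x) (\<phi> g y)"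
      using side_image[OF g K(1)] act_mem_image_act_iff[OF g side_subset[OF K(1)]] x y
      by (simp add: side_separators_def)
  qed
  moreover have "inj_on ((`) (\<phi> g)) (side_separators x y)"
  proof (rule inj_onI)
    fix J K assume "J \<in> side_separators x y" "K \<in> side_separators x y" "\<phi> g ` J = \<phi> g ` K"
    then show "J = K"
      using inj_on_image_eq_iff[OF inj_prop[OF g] side_subset side_subset]
      by (simp add: side_separators_def)
  qed
  ultimately show ?thesis
    by (simp add: orbit_dist_eq card_image)
qed

section \<open>The quotient median algebra\<close>

lemma orbit_cong_iff:
  "(x, y) \<in> orbit_cong G M \<phi> m H \<longleftrightarrow> x \<in> M \<and> y \<in> M \<and> (\<forall>J\<in>sides. x \<in> J \<longleftrightarrow> y \<in> J)"
proof -
  have "d x y = 0 \<longleftrightarrow> (\<forall>J\<in>sides. x \<in> J \<longleftrightarrow> y \<in> J)" if xy: "x \<in> M" "y \<in> M"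
  proof -
    have "d x y = 0 \<longleftrightarrow> side_separators x y = {}"
      using finite_side_separators[OF xy] by (simp add: orbit_dist_eq)
    also have "\<dots> \<longleftrightarrow> (\<forall>J\<in>sides. x \<in> J \<longrightarrow> y \<in> J)"
      by (auto simp: side_separators_def)
    also have "\<dots> \<longleftrightarrow> (\<forall>J\<in>sides. x \<in> J \<longleftrightarrow> y \<in> J)"
      using side_complement xy by blast
    finally show ?thesis .
  qed
  then show ?thesis
    by (auto simp: orbit_cong_def)
qed

definition cls :: "'a \<Rightarrow> 'a set" where
  "cls x = {y \<in> M. \<forall>J\<in>sides. x \<in> J \<longleftrightarrow> y \<in> J}"

abbreviation "Q \<equiv> quotient_carrier G M \<phi> m H"

abbreviation "mQ \<equiv> quotient_median G M \<phi> m H"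

lemma orbit_cong_image: "x \<in> M \<Longrightarrow> orbit_cong G M \<phi> m H `` {x} = cls x"
  unfolding Image_singleton orbit_cong_iff cls_def by simp

lemma quotient_carrier_eq: "Q = cls ` M"
proof -
  have "Q = (\<lambda>x. orbit_cong G M \<phi> m H `` {x}) ` M"
    by (auto simp: quotient_carrier_def quotient_def)
  also have "\<dots> = cls ` M"
    using orbit_cong_image by (intro image_cong refl)
  finally show ?thesis .
qed

lemma mem_cls_self: "x \<in> M \<Longrightarrow> x \<in> cls x"
  by (simp add: cls_def)

lemma cls_eq_iff:
  assumes "x \<in> M" "y \<in> M"
  shows "cls x = cls y \<longleftrightarrow> (\<forall>J\<in>sides. x \<in> J \<longleftrightarrow> y \<in> J)"
proof
  assume "cls x = cls y"
  then have "y \<in> cls x" using mem_cls_self assms(2) by simp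
  then show "\<forall>J\<in>sides. x \<in> J \<longleftrightarrow> y \<in> J"
    unfolding cls_def by blast
next
  assume a: "\<forall>J\<in>sides. x \<in> J \<longleftrightarrow> y \<in> J"
  have "(\<forall>J\<in>sides. x \<in> J \<longleftrightarrow> z \<in> J) \<longleftrightarrow> (\<forall>J\<in>sides. y \<in> J \<longleftrightarrow> z \<in> J)" for z
    by (rule ball_cong[OF refl]) (simp add: bspec[OF a])
  then show "cls x = cls y"
    unfolding cls_def by (simp only:)
qed

lemma cls_mem_image_side_iff:
  assumes J: "J \<in> sides" and x: "x \<in> M"
  shows "cls x \<in> cls ` J \<longleftrightarrow> x \<in> J"
proof
  assume "cls x \<in> cls ` J"
  then obtain y where y: "y \<in> J" "cls x = cls y" by (rule imageE)
  then have "y \<in> M" using side_subset[OF J] by blast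
  then show "x \<in> J" using y x J by (simp add: cls_eq_iff)
qed simp

text \<open>
  Membership of a median in a half space is decided by the majority of its arguments, so
  equivalent points may be exchanged.
\<close>

lemma quotient_median_cls:
  assumes xyz: "x \<in> M" "y \<in> M" "z \<in> M"
  shows "mQ (cls x) (cls y) (cls z) = cls (m x y z)"
proof -
  have "orbit_cong G M \<phi> m H `` {m a b c} = cls (m x y z)"
    if abc: "a \<in> cls x" "b \<in> cls y" "c \<in> cls z" for a b c
  proof -
    have M: "a \<in> M" "b \<in> M" "c \<in> M"
      using abc by (auto simp: cls_def)
    have "m a b c \<in> J \<longleftrightarrow> m x y z \<in> J" if J: "J \<in> sides" for J
      using median_mem_halfspace_iff[OF side_halfspace[OF J]] M xyz abc J
      by (simp add: cls_def)
    then show ?thesis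
      using orbit_cong_image cls_eq_iff closed M xyz by simp
  qed
  moreover have "cls x \<noteq> {}" "cls y \<noteq> {}" "cls z \<noteq> {}"
    using mem_cls_self xyz by blast+
  ultimately show ?thesis
    by (simp add: quotient_median_def)
qed

lemma image_side_halfspace:
  assumes J: "J \<in> sides"
  shows "halfspace Q mQ (cls ` J)"
proof -
  have convex: "median_convex Q mQ (cls ` K)" if K: "K \<in> sides" for K
  proof -
    have "Z \<in> cls ` K"
      if a: "a \<in> K" and b: "b \<in> K" and Z: "Z \<in> interval Q mQ (cls a) (cls b)" for a b Z
    proof -
      have ab: "a \<in> M" "b \<in> M"
        by (rule subsetD[OF side_subset[OF K] a], rule subsetD[OF side_subset[OF K] b])
      obtain c where c: "c \<in> M" "Z = cls c"
        using Z by (auto simp: interval_def quotient_carrier_eq)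
      have "cls c = cls (m a b c)"
        using Z c ab by (simp add: interval_def quotient_median_cls)
      moreover have "m a b c \<in> K"
        using a b ab c(1) side_halfspace[OF K] by (simp add: median_mem_halfspace_iff)
      ultimately show ?thesis using c(2) by blast
    qed
    then show ?thesis
      using side_subset[OF K] by (auto simp: median_convex_def quotient_carrier_eq)
  qed
  have "Q - cls ` J = cls ` (M - J)"
    unfolding quotient_carrier_eq using cls_mem_image_side_iff[OF J] by auto
  then show ?thesis
    using convex[OF J] convex[OF side_complement[OF J]] by (auto simp: halfspace_def median_convex_def)
qed

text \<open>
  The preimage \<open>K\<close> of a proper half space of the quotient is a proper half space of \<open>M\<close>.
  Some pair of points of \<open>M\<close> is separated by \<open>K\<close> alone. The two points have different
  classes, hence are also separated by a side of the orbit of \<open>H\<close>, which must be \<open>K\<close>.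
\<close>

lemma quotient_halfspace_is_image_of_side:
  assumes P: "proper_halfspace Q mQ P"
  obtains J where "J \<in> sides" "P = cls ` J"
proof -
  define K where "K = {x \<in> M. cls x \<in> P}"
  have PQ: "P \<subseteq> Q" and Phs: "halfspace Q mQ P"
    using P by (auto simp: proper_halfspace_def halfspace_def)
  have convex: "median_convex M m {x \<in> M. cls x \<in> R}" if R: "median_convex Q mQ R" for R
  proof -
    have "cls z \<in> R"
      if "a \<in> M" "b \<in> M" "cls a \<in> R" "cls b \<in> R" and z: "z \<in> interval M m a b" for a b z
    proof -
      have "cls z \<in> interval Q mQ (cls a) (cls b)"
        using z that(1,2) by (auto simp: interval_def quotient_median_cls quotient_carrier_eq)
      then show ?thesis
        using R that(3,4) unfolding median_convex_def by blast
    qed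
    then show ?thesis
      by (auto simp: median_convex_def interval_def)
  qed
  have "M - K = {x \<in> M. cls x \<in> Q - P}"
    by (auto simp: K_def quotient_carrier_eq)
  then have "halfspace M m K"
    using convex[of P] convex[of "Q - P"] Phs unfolding halfspace_def K_def by auto
  moreover have PK: "P = cls ` K"
    using PQ by (auto simp: K_def quotient_carrier_eq)
  ultimately have "proper_halfspace M m K"
    using P quotient_carrier_eq by (auto simp: proper_halfspace_def)
  then obtain x y where xy: "x \<in> K" "y \<in> M - K" "separators M m x y = {K}"
    using exists_pair_separated_only_by by blast
  have "x \<in> M" "y \<in> M" and "cls x \<noteq> cls y"
    using xy(1,2) by (auto simp: K_def)
  then have "(x, y) \<notin> orbit_cong G M \<phi> m H"
    using orbit_cong_iff cls_eq_iff by simp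
  then have "side_separators x y \<noteq> {}"
    using \<open>x \<in> M\<close> \<open>y \<in> M\<close> by (auto simp: orbit_cong_def orbit_dist_eq)
  moreover have "side_separators x y \<subseteq> {K}"
    using side_separators_subset[of x y] xy(3) by simp
  ultimately have "K \<in> side_separators x y"
    by (simp add: subset_singleton_iff)
  then show thesis
    using that[OF _ PK] by (simp add: side_separators_def)
qed

text \<open>
  The empty and the full half space separate nothing, so the half spaces that separate two
  classes are the images of the sides that separate representatives.
\<close>

lemma quotient_median_dist:
  assumes x: "x \<in> M" and y: "y \<in> M"
  shows "median_dist Q mQ (cls x) (cls y) = d x y"
proof -
  have "separators Q mQ (cls x) (cls y) = (`) cls ` side_separators x y"
  proof (intro equalityI subsetI)
    fix P assume P: "P \<in> separators Q mQ (cls x) (cls y)"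
    then have "proper_halfspace Q mQ P"
      using y by (auto simp: separators_def proper_halfspace_def quotient_carrier_eq)
    then obtain J where J: "J \<in> sides" "P = cls ` J"
      by (rule quotient_halfspace_is_image_of_side)
    then have "J \<in> side_separators x y"
      using P x y cls_mem_image_side_iff[OF J(1)] by (auto simp: separators_def side_separators_def)
    then show "P \<in> (`) cls ` side_separators x y"
      using J(2) by blast
  next
    fix P assume "P \<in> (`) cls ` side_separators x y"
    then obtain J where "J \<in> sides" "x \<in> J" "y \<notin> J" "P = cls ` J"
      by (auto simp: side_separators_def)
    then show "P \<in> separators Q mQ (cls x) (cls y)"
      using y image_side_halfspace cls_mem_image_side_iff by (auto simp: separators_def)
  qed
  moreover have "inj_on ((`) cls) (side_separators x y)"
  proof (rule inj_onI)
    fix J K assume "J \<in> side_separators x y" "K \<in> side_separators x y" and eq: "cls ` J = cls ` K"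
    then have JK: "J \<in> sides" "K \<in> sides" by (auto simp: side_separators_def)
    have "a \<in> J \<longleftrightarrow> a \<in> K" if "a \<in> M" for a
      using cls_mem_image_side_iff[OF JK(1) that] cls_mem_image_side_iff[OF JK(2) that] eq by simp
    then show "J = K"
      using side_subset[OF JK(1)] side_subset[OF JK(2)] by blast
  qed
  ultimately show ?thesis
    by (simp add: median_dist_def orbit_dist_eq card_image)
qed

lemma act_cls_subset:
  assumes g: "g \<in> carrier G" and x: "x \<in> M"
  shows "\<phi> g ` cls x \<subseteq> cls (\<phi> g x)"
proof
  fix w assume "w \<in> \<phi> g ` cls x"
  then obtain y where y: "y \<in> cls x" "w = \<phi> g y" by blast
  have yM: "y \<in> M" using y(1) by (simp add: cls_def)
  have "\<phi> g x \<in> J \<longleftrightarrow> \<phi> g y \<in> J" if J: "J \<in> sides" for J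
  proof -
    let ?K = "\<phi> (inv g) ` J"
    have K: "?K \<in> sides" and JK: "J = \<phi> g ` ?K"
      using side_image[OF _ J, of "inv g"] image_inv_image[OF g side_subset[OF J]] g by simp_all
    have "\<phi> g a \<in> J \<longleftrightarrow> a \<in> ?K" if "a \<in> M" for a
      using act_mem_image_act_iff[OF g side_subset[OF K] that] JK by simp
    then show ?thesis
      using y(1) x yM K by (simp add: cls_def)
  qed
  then show "w \<in> cls (\<phi> g x)"
    using y(2) yM act_closed[OF g] by (simp add: cls_def)
qed

lemma quotient_action_cls:
  assumes g: "g \<in> carrier G" and x: "x \<in> M"
  shows "quotient_action G M \<phi> m H g (cls x) = cls (\<phi> g x)"
proof -
  have "cls (\<phi> g x) \<subseteq> \<phi> g ` cls x"
  proof
    fix w assume w: "w \<in> cls (\<phi> g x)"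
    then have wM: "w \<in> M" by (simp add: cls_def)
    have "\<phi> (inv g) w \<in> cls x"
      using act_cls_subset[of "inv g" "\<phi> g x"] w g x act_closed[OF g x] act_inv_act[OF g x] by auto
    then show "w \<in> \<phi> g ` cls x"
      using act_act_inv[OF g wM] by (metis imageI)
  qed
  then show ?thesis
    using act_cls_subset[OF g x] x by (auto simp: quotient_action_def quotient_carrier_eq)
qed

section \<open>Displacement of base points\<close>

definition bounded_orbit :: "'a \<Rightarrow> bool" where
  "bounded_orbit x \<longleftrightarrow> bdd_above {d x (\<phi> g x) | g. g \<in> carrier G}"

lemma bounded_orbit_iff: "bounded_orbit x \<longleftrightarrow> (\<exists>N. \<forall>g\<in>carrier G. d x (\<phi> g x) \<le> N)"
  unfolding bounded_orbit_def bdd_above_def by blast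

lemma bounded_orbit_change_base:
  assumes x: "x \<in> M" and y: "y \<in> M" and b: "bounded_orbit x"
  shows "bounded_orbit y"
proof -
  obtain N where N: "\<And>g. g \<in> carrier G \<Longrightarrow> d x (\<phi> g x) \<le> N"
    using b by (auto simp: bounded_orbit_iff)
  have "d y (\<phi> g y) \<le> d y x + N + d x y" if g: "g \<in> carrier G" for g
    using orbit_dist_triangle[OF y x act_closed[OF g y]]
      orbit_dist_triangle[OF x act_closed[OF g x] act_closed[OF g y]]
      orbit_dist_invariant[OF g x y] N[OF g] by linarith
  then show ?thesis
    by (auto simp: bounded_orbit_iff)
qed

lemma elliptic_quotient_iff:
  "elliptic G Q (quotient_action G M \<phi> m H) mQ \<longleftrightarrow> (\<exists>x\<in>M. bounded_orbit x)"
proof -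
  have "median_bounded Q mQ (orbit G (quotient_action G M \<phi> m H) (cls x)) \<longleftrightarrow> bounded_orbit x"
    if x: "x \<in> M" for x
  proof -
    have orb: "orbit G (quotient_action G M \<phi> m H) (cls x) = {cls (\<phi> g x) | g. g \<in> carrier G}"
      unfolding orbit_def using quotient_action_cls[OF _ x] by (metis (lifting))
    have dist: "median_dist Q mQ (cls (\<phi> g x)) (cls (\<phi> h x)) = d x (\<phi> (inv g \<otimes> h) x)"
      if gh: "g \<in> carrier G" "h \<in> carrier G" for g h
    proof -
      have "\<phi> h x = \<phi> g (\<phi> (inv g \<otimes> h) x)"
        using gh x by (simp add: composition_rule act_closed act_act_inv)
      then show ?thesis
        using gh x orbit_dist_invariant[OF gh(1) x act_closed[OF _ x]]
        by (simp add: quotient_median_dist act_closed)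
    qed
    have "{median_dist Q mQ X Y | X Y. X \<in> orbit G (quotient_action G M \<phi> m H) (cls x) \<and>
          Y \<in> orbit G (quotient_action G M \<phi> m H) (cls x)}
        = {d x (\<phi> g x) | g. g \<in> carrier G}" (is "?L = ?R")
    proof (intro equalityI subsetI)
      fix n assume "n \<in> ?L"
      then obtain g h where gh: "g \<in> carrier G" "h \<in> carrier G"
        and "n = median_dist Q mQ (cls (\<phi> g x)) (cls (\<phi> h x))"
        by (auto simp: orb)
      then have "n = d x (\<phi> (inv g \<otimes> h) x)"
        using dist by simp
      then show "n \<in> ?R"
        using gh by blast
    next
      fix n assume "n \<in> ?R"
      then obtain g where g: "g \<in> carrier G" "n = d x (\<phi> g x)" by blast
      then have "n = median_dist Q mQ (cls (\<phi> \<one> x)) (cls (\<phi> g x))"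
        using dist[of \<one> g] by simp
      then show "n \<in> ?L"
        using g(1) orb by blast
    qed
    then show ?thesis
      by (simp add: median_bounded_def bounded_orbit_def)
  qed
  then show ?thesis
    by (auto simp: elliptic_def quotient_carrier_eq)
qed

abbreviation "around x \<equiv> {J \<in> T. x \<in> J}"

abbreviation "avoiding x \<equiv> {J \<in> T. x \<notin> J}"

text \<open>
  Passing to \<open>M - H\<close> leaves \<open>d\<close> unchanged and exchanges the translates that contain \<open>x\<close>
  with those that avoid it. Each result about \<open>H\<close> below thereby has a dual.
\<close>

lemma halfspace_action_complement: "halfspace_action G M \<phi> m (M - H)"
proof unfold_locales
  show "proper_halfspace M m (M - H)"
    using proper_H halfspace_complement[OF H_halfspace] H_subset
    unfolding proper_halfspace_def by blast
qed

lemma orbit_dist_complement: "orbit_dist G M \<phi> m (M - H) = d"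
  by (simp add: fun_eq_iff orbit_dist_def hyperplane_orbit_def hyperplane_complement H_subset)

lemma bounded_orbit_complement:
  "halfspace_action.bounded_orbit G M \<phi> m (M - H) = bounded_orbit"
proof -
  interpret opp: halfspace_action G M \<phi> m "M - H"
    by (rule halfspace_action_complement)
  show ?thesis
    by (intro ext) (simp only: opp.bounded_orbit_def bounded_orbit_def orbit_dist_complement)
qed

lemma around_complement:
  assumes "x \<in> M"
  shows "{J \<in> translates G \<phi> (M - H). x \<in> J} = (\<lambda>J. M - J) ` avoiding x"
  using assms by (auto simp: translates_complement)

lemma translates_complement_finite_iff: "finite (translates G \<phi> (M - H)) \<longleftrightarrow> finite T"
  unfolding translates_complement
proof (rule finite_image_iff, rule inj_onI)
  fix J K assume "J \<in> T" "K \<in> T" "M - J = M - K"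
  then show "J = K"
    using translate_subset by (metis double_diff subset_refl)
qed

lemma around_act:
  assumes g: "g \<in> carrier G" and x: "x \<in> M"
  shows "around (\<phi> g x) = (`) (\<phi> g) ` around x"
proof (intro equalityI subsetI)
  fix J assume "J \<in> around (\<phi> g x)"
  then have J: "J \<in> T" "\<phi> g x \<in> J" by auto
  let ?K = "\<phi> (inv g) ` J"
  have K: "?K \<in> T" and JK: "\<phi> g ` ?K = J"
    using g J(1) translate_image image_inv_image[OF g translate_subset] by simp_all
  have "x \<in> ?K"
    using act_mem_image_act_iff[OF g translate_subset[OF K] x] J(2) JK by simp
  then show "J \<in> (`) (\<phi> g) ` around x"
    using K JK by (metis (mono_tags, lifting) image_eqI mem_Collect_eq)
next
  fix J assume "J \<in> (`) (\<phi> g) ` around x"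
  then show "J \<in> around (\<phi> g x)"
    using translate_image[OF g] by blast
qed

text \<open>
  A hyper plane that separates \<open>x\<close> from \<open>gx\<close> is given by a translate around exactly one of
  the two points, and both points lie in equally many translates.
\<close>

lemma bounded_orbit_if_finite_around:
  assumes x: "x \<in> M" and fin: "finite (around x)"
  shows "bounded_orbit x"
proof -
  have "d x (\<phi> g x) \<le> card (around x) + card (around x)" if g: "g \<in> carrier G" for g
  proof -
    let ?A' = "around (\<phi> g x)"
    have A': "finite ?A'" "card ?A' \<le> card (around x)"
      unfolding around_act[OF g x] using fin card_image_le by blast+
    have "side_separators x (\<phi> g x) \<subseteq> around x \<union> (\<lambda>J. M - J) ` ?A'"
      using act_closed[OF g x] by (auto simp: side_separators_def sides_def translates_complement)
    then have "d x (\<phi> g x) \<le> card (around x \<union> (\<lambda>J. M - J) ` ?A')"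
      unfolding orbit_dist_eq using fin A'(1) by (intro card_mono) simp_all
    also have "\<dots> \<le> card (around x) + card ((\<lambda>J. M - J) ` ?A')"
      by (rule card_Un_le)
    finally show ?thesis
      using card_image_le[OF A'(1), of "\<lambda>J. M - J"] A'(2) by linarith
  qed
  then show ?thesis
    unfolding bounded_orbit_iff by blast
qed

lemma bounded_orbit_if_finite_avoiding:
  assumes x: "x \<in> M" and fin: "finite (avoiding x)"
  shows "bounded_orbit x"
proof -
  interpret opp: halfspace_action G M \<phi> m "M - H"
    by (rule halfspace_action_complement)
  show ?thesis
    using opp.bounded_orbit_if_finite_around[OF x] fin
    unfolding around_complement[OF x] bounded_orbit_complement by simp
qed

text \<open>
  Since \<open>g\<close> sends the translates around \<open>x\<close> to those around \<open>gx\<close>, a bound on \<open>d x (gx)\<close>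
  says that the set of translates around \<open>x\<close> changes by a bounded amount under each group
  element.
\<close>

lemma finite_around_or_avoiding_if_bounded_orbit:
  assumes inf: "infinite T" and x: "x \<in> M" and b: "bounded_orbit x"
  shows "finite (around x) \<or> finite (avoiding x)"
proof -
  obtain N where N: "\<And>g. g \<in> carrier G \<Longrightarrow> d x (\<phi> g x) \<le> N"
    using b by (auto simp: bounded_orbit_iff)
  let ?\<psi> = "\<lambda>g. \<lambda>J\<in>T. \<phi> g ` J"
  interpret act: transitive_action G T ?\<psi>
    using transitive_action_on_translates[OF H_subset] .
  have "finite (around x) \<or> finite (T - around x)"
  proof (rule act.finite_or_cofinite_if_bounded_displacement[OF inf])
    fix g assume g: "g \<in> carrier G"
    let ?y = "\<phi> g x" and ?D = "sym_diff (around x) (?\<psi> g ` around x)"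
    have y: "?y \<in> M" by (rule act_closed[OF g x])
    have "?\<psi> g ` around x = around ?y"
      unfolding around_act[OF g x] by (intro image_cong refl) simp
    then have sub: "?D \<subseteq> side_separators x ?y \<union> side_separators ?y x"
      by (auto simp: side_separators_def sides_def)
    have fin: "finite (side_separators x ?y \<union> side_separators ?y x)"
      using finite_side_separators x y by simp
    have "d ?y x = d x (\<phi> (inv g) x)"
      using orbit_dist_invariant[OF inv_closed[OF g] y x] act_inv_act[OF g x] by simp
    then have "d x ?y + d ?y x \<le> N + N"
      using N[OF g] N[OF inv_closed[OF g]] by linarith
    moreover have "card ?D \<le> d x ?y + d ?y x"
      unfolding orbit_dist_eq by (rule le_trans[OF card_mono[OF fin sub] card_Un_le])
    ultimately show "finite ?D \<and> card ?D \<le> N + N"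
      using finite_subset[OF sub fin] le_trans by blast
  qed simp
  moreover have "T - around x = avoiding x" by blast
  ultimately show ?thesis by simp
qed

lemma unbounded_orbit_iff:
  assumes x: "x \<in> M"
  shows "\<not> bounded_orbit x \<longleftrightarrow> infinite (around x) \<and> infinite (avoiding x)"
proof -
  have "finite T \<Longrightarrow> finite (around x)" by simp
  then show ?thesis
    using bounded_orbit_if_finite_around[OF x] bounded_orbit_if_finite_avoiding[OF x]
      finite_around_or_avoiding_if_bounded_orbit[OF _ x] by argo
qed

section \<open>Essential half spaces\<close>

text \<open>
  If all distances in \<open>H \<inter> Gx\<close> were at most \<open>N\<close>, then the same would hold for every
  translate of \<open>H\<close>. A point \<open>gx\<close> with \<open>d x (gx) > N\<close> then lies in none of the infinitely
  many translates around \<open>x\<close>, although only finitely many separate \<open>x\<close> from \<open>gx\<close>.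
\<close>

lemma unbounded_inter_orbit:
  assumes x: "x \<in> M" and nb: "\<not> bounded_orbit x"
  shows "\<not> median_bounded M m (H \<inter> orbit G \<phi> x)"
proof
  assume "median_bounded M m (H \<inter> orbit G \<phi> x)"
  then obtain N where N: "\<And>a b. \<lbrakk>a \<in> H \<inter> orbit G \<phi> x; b \<in> H \<inter> orbit G \<phi> x\<rbrakk>
      \<Longrightarrow> median_dist M m a b \<le> N"
    unfolding median_bounded_def bdd_above_def by blast
  obtain g where g: "g \<in> carrier G" "\<not> d x (\<phi> g x) \<le> N"
    using nb unfolding bounded_orbit_iff by blast
  have gx: "\<phi> g x \<in> M" by (rule act_closed[OF g(1) x])
  have "around x \<subseteq> side_separators x (\<phi> g x)"
  proof
    fix J assume J: "J \<in> around x"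
    have "\<phi> g x \<notin> J"
    proof
      assume gxJ: "\<phi> g x \<in> J"
      obtain h where h: "h \<in> carrier G" "J = \<phi> h ` H"
        using J by (auto simp: translates_def)
      let ?a = "\<phi> (inv h) x" and ?b = "\<phi> (inv h) (\<phi> g x)"
      have "?a \<in> H" "?b \<in> H"
        using J gxJ h act_mem_image_iff[OF h(1) H_subset] x gx by auto
      moreover have "?b = \<phi> (inv h \<otimes> g) x"
        using composition_rule[OF x _ g(1)] h(1) by simp
      then have "?a \<in> orbit G \<phi> x" "?b \<in> orbit G \<phi> x"
        using h(1) g(1) unfolding orbit_def by auto
      ultimately have "median_dist M m ?a ?b \<le> N"
        using N by blast
      moreover have "d ?a ?b \<le> median_dist M m ?a ?b"
        using x gx h(1) act_closed by (intro orbit_dist_le_median_dist) simp_all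
      moreover have "d ?a ?b = d x (\<phi> g x)"
        using orbit_dist_invariant[OF inv_closed[OF h(1)] x gx] .
      ultimately show False using g(2) by simp
    qed
    then show "J \<in> side_separators x (\<phi> g x)"
      using J by (simp add: side_separators_def sides_def)
  qed
  then have "finite (around x)"
    using finite_side_separators[OF x gx] finite_subset by blast
  then show False
    using bounded_orbit_if_finite_around[OF x] nb by blast
qed

text \<open>
  Choose \<open>g\<close> and \<open>h\<close> such that the translates around \<open>x\<close>, around \<open>gx\<close> and around \<open>hx\<close>
  are three pairwise disjoint finite families. No translate contains two of the three
  points, so no translate contains their median \<open>y\<close>, and the orbit of \<open>y\<close> misses \<open>H\<close>.
\<close>

lemma exists_orbit_disjoint_from_halfspace:
  assumes inf: "infinite T" and x: "x \<in> M" and fin: "finite (around x)"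
  shows "\<exists>y\<in>M. H \<inter> orbit G \<phi> y = {}"
proof -
  let ?\<psi> = "\<lambda>g. \<lambda>J\<in>T. \<phi> g ` J"
  interpret act: transitive_action G T ?\<psi>
    using transitive_action_on_translates[OF H_subset] .
  have orbit_inf: "infinite (orbit G ?\<psi> J)" if "J \<in> T" for J
  proof -
    have "T \<subseteq> orbit G ?\<psi> J"
      using act.unique_orbit[OF that] unfolding orbit_def by blast
    then show ?thesis using inf finite_subset by blast
  qed
  have move: "\<exists>g\<in>carrier G. around (\<phi> g x) \<inter> F = {}" if F: "finite F" for F
  proof -
    obtain g where g: "g \<in> carrier G" "?\<psi> g ` around x \<inter> F = {}"
      using act.exists_disjoint_translate[OF fin _ F orbit_inf] by blast
    moreover have "?\<psi> g ` around x = around (\<phi> g x)"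
      unfolding around_act[OF g(1) x] by (intro image_cong refl) simp
    ultimately show ?thesis by auto
  qed
  obtain g where g: "g \<in> carrier G" "around (\<phi> g x) \<inter> around x = {}"
    using move[OF fin] by blast
  have "finite (around x \<union> around (\<phi> g x))"
    unfolding around_act[OF g(1) x] using fin by simp
  then obtain h where h: "h \<in> carrier G" "around (\<phi> h x) \<inter> (around x \<union> around (\<phi> g x)) = {}"
    using move by blast
  define y where "y = m x (\<phi> g x) (\<phi> h x)"
  have gx: "\<phi> g x \<in> M" and hx: "\<phi> h x \<in> M"
    using act_closed g(1) h(1) x by simp_all
  have yM: "y \<in> M"
    unfolding y_def using closed x gx hx by simp
  have avoid: "y \<notin> J" if J: "J \<in> T" for J
  proof -
    have "\<not> (x \<in> J \<and> \<phi> g x \<in> J)" "\<not> (x \<in> J \<and> \<phi> h x \<in> J)" "\<not> (\<phi> g x \<in> J \<and> \<phi> h x \<in> J)"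
      using g(2) h(2) J by blast+
    then show ?thesis
      unfolding y_def using median_mem_halfspace_iff[OF translate_halfspace[OF J] x gx hx] by blast
  qed
  have "\<phi> k y \<notin> H" if k: "k \<in> carrier G" for k
  proof
    assume "\<phi> k y \<in> H"
    then have "y \<in> \<phi> (inv k) ` H"
      using act_inv_act[OF k yM] by (metis imageI)
    then show False
      using avoid k by (auto simp: translates_def)
  qed
  then show ?thesis
    using yM by (auto simp: orbit_def)
qed

lemma infinite_around_if_unbounded_inter_orbit:
  assumes inf: "infinite T" and x: "x \<in> M"
    and cut: "\<And>y. y \<in> M \<Longrightarrow> \<not> median_bounded M m (H \<inter> orbit G \<phi> y)"
  shows "infinite (around x)"
proof
  assume "finite (around x)"
  then obtain y where "y \<in> M" "H \<inter> orbit G \<phi> y = {}"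
    using exists_orbit_disjoint_from_halfspace[OF inf x] by blast
  then show False
    using cut[of y] by (simp add: median_bounded_def)
qed

text \<open>
  The two halves of proper cutting, for \<open>H\<close> and for \<open>M - H\<close>, correspond to the infinitude
  of the translates around \<open>x\<close> and of those avoiding \<open>x\<close>.
\<close>

lemma essential_iff: "essential G M \<phi> m H \<longleftrightarrow> (\<forall>x\<in>M. \<not> bounded_orbit x)"
proof -
  interpret opp: halfspace_action G M \<phi> m "M - H"
    by (rule halfspace_action_complement)
  show ?thesis
  proof (intro iffI ballI)
    fix x assume ess: "essential G M \<phi> m H" and x: "x \<in> M"
    have "infinite (around x)"
      using ess infinite_around_if_unbounded_inter_orbit[OF _ x]
      by (simp add: essential_def cuts_properly_def)
    moreover have "infinite {J \<in> translates G \<phi> (M - H). x \<in> J}"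
      using ess opp.infinite_around_if_unbounded_inter_orbit[OF _ x]
      by (simp add: essential_def cuts_properly_def translates_complement_finite_iff)
    then have "infinite (avoiding x)"
      unfolding around_complement[OF x] by blast
    ultimately show "\<not> bounded_orbit x"
      using unbounded_orbit_iff[OF x] by simp
  next
    assume nb: "\<forall>x\<in>M. \<not> bounded_orbit x"
    obtain x where x: "x \<in> M" using nonempty by blast
    have "infinite (around x)"
      using nb x unbounded_orbit_iff by simp
    then have "infinite T"
      by (rule contrapos_nn) simp
    moreover have "cuts_properly G M \<phi> m H"
      using nb unbounded_inter_orbit opp.unbounded_inter_orbit
      by (simp add: cuts_properly_def bounded_orbit_complement)
    ultimately show "essential G M \<phi> m H"
      by (simp add: essential_def)
  qed
qed

end

theorem proposition11p20:
  fixes G :: "('g, 'c) monoid_scheme"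
    and M H :: "'a set"
    and \<phi> :: "'g \<Rightarrow> 'a \<Rightarrow> 'a"
    and m :: "'a \<Rightarrow> 'a \<Rightarrow> 'a \<Rightarrow> 'a"
  assumes "discrete_median_action G M \<phi> m"
    and "proper_halfspace M m H"
  defines "i \<equiv> essential G M \<phi> m H"
    and "ii \<equiv> \<exists>x\<in>M. infinite {J \<in> translates G \<phi> H. x \<in> J} \<and>
                    infinite {J \<in> translates G \<phi> H. x \<notin> J}"
    and "iii \<equiv> \<exists>x\<in>M. \<not> bdd_above {orbit_dist G M \<phi> m H x (\<phi> g x) | g. g \<in> carrier G}"
    and "iv \<equiv> \<not> elliptic G (quotient_carrier G M \<phi> m H) (quotient_action G M \<phi> m H)
                       (quotient_median G M \<phi> m H)"
  shows "(i \<longleftrightarrow> ii) \<and> (ii \<longleftrightarrow> iii) \<and> (iii \<longleftrightarrow> iv)"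
proof -
  interpret halfspace_action G M \<phi> m H
    using assms(1,2) by (simp add: halfspace_action_def halfspace_action_axioms_def)
  \<comment> \<open>Proper cutting and non ellipticity speak of all base points, (ii) and (iii) of some.\<close>
  have all_iff_some: "(\<forall>x\<in>M. \<not> bounded_orbit x) \<longleftrightarrow> (\<exists>x\<in>M. \<not> bounded_orbit x)"
    using bounded_orbit_change_base nonempty by blast
  have iii_iff: "iii \<longleftrightarrow> (\<exists>x\<in>M. \<not> bounded_orbit x)"
    by (simp only: iii_def bounded_orbit_def)
  have "ii \<longleftrightarrow> iii"
    unfolding ii_def iii_iff by (rule bex_cong[OF refl]) (rule unbounded_orbit_iff[symmetric])
  moreover have "i \<longleftrightarrow> iii"
    unfolding i_def iii_iff essential_iff by (rule all_iff_some)
  moreover have "iv \<longleftrightarrow> iii"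
    unfolding iv_def iii_iff elliptic_quotient_iff using all_iff_some by blast
  ultimately show ?thesis by blast
qed

end
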